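(* Let $X$ be an abelian surface over a field with $\mathrm{NS}(X)=\mathbb ZH$, $H$ ample, $n=(H^2)/2$. Let $\ell>1$ be an integer with $\sqrt{\ell n}\notin\mathbb Z$, and $v=1-\ell\varrho_X$. Consider the walls for $v$ in the $(s,t)$-plane, in particular the walls $C_0$ and $C_{-1}$. (1) There are finitely many walls between $C_0$ and $C_{-1}$. (2) By the action of $G_{n,\ell}$, every wall is transformed to a wall between $C_0$ and $C_{-1}$ (the walls $C_0$ and $C_{-1}$ included).
   Context: $H^*(X,\mathbb Z)_{\mathrm{alg}}=\mathbb Z\oplus \mathrm{NS}(X)\oplus\mathbb Z\varrho_X$, elements written $(r,dH,a)$, carries the Mukai pairing $\langle x,y\rangle=(x_1,y_1)-(x_0y_2+x_2y_0)$. Identify $(r,dH,a)$ with the symmetric matrix $\begin{pmatrix} r & d\sqrt n \\ d\sqrt n & a \end{pmatrix}$. Let $\widehat G$ be the group of matrices $\begin{pmatrix} a\sqrt r & b\sqrt{s'} \\ c\sqrt{s'} & d\sqrt r \end{pmatrix}$ with $a,b,c,d,r,s'\in\mathbb Z$, $r,s'>0$, $rs'=n$, $adr-bcs'=\pm1$. It acts on the Mukai lattice from the right by isometries: $M\cdot g={}^tg\,M\,g$. $G_{n,\ell}=\{g\in\widehat G\mid {}^tg\begin{pmatrix} 1 & 0 \\ 0 & -\ell \end{pmatrix}g=\pm\begin{pmatrix} 1 & 0 \\ 0 & -\ell \end{pmatrix}\}$, i.e. the elements with $v\cdot g=\pm v$. $Z_{(\beta,\omega)}(w)=\langle e^{\beta+\sqrt{-1}\omega},w\rangle$.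 The $(s,t)$-plane is $\{s\in\mathbb R,t>0\}$. A wall for $v$ is a nonempty set $W_{v_1}=\{(s,t)\mid\mathbb RZ_{(sH,tH)}(v_1)=\mathbb RZ_{(sH,tH)}(v)\}$, where $v_1\notin\mathbb Qv$, $\langle v_1^2\rangle\ge0$, $\langle(v-v_1)^2\rangle\ge0$, $\langle v_1,v-v_1\rangle>0$. An element $g\in G_{n,\ell}$ sends the wall $W_{v_1}$ to the wall $\{(s,t)\mid\mathbb RZ_{(sH,tH)}(v_1\cdot g)=\mathbb RZ_{(sH,tH)}(v)\}$. Let $S_{n,\ell}$ be the group of matrices $\begin{pmatrix} y & \ell x \\ x & y \end{pmatrix}$ with $x=a\sqrt r$, $y=b\sqrt{s'}$, $a,b,r,s'\in\mathbb Z$, $r,s'>0$, $rs'=n$, $y^2-\ell x^2=\pm1$, and let $\begin{pmatrix} q & \ell p \\ p & q \end{pmatrix}$, $p,q>0$, be the generator of $S_{n,\ell}/\{\pm1\}$. $C_0$ is the wall $s=0$ (defined by $1=(1,0,0)$, equivalently $\varrho_X$), and $C_{-1}$ is the wall $\left(s+\frac{q}{p\sqrt n}\right)\left(s+\frac{\ell p}{q\sqrt n}\right)+t^2=0$. Distinct walls are disjoint; walls other than $C_0$ are semicircles not meeting $s=0$, and a wall is between $C_0$ and $C_{-1}$ if it lies in $s<0$ and surrounds $C_{-1}$. *)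

theory Defs
  imports "HOL-Analysis.Analysis" "HOL-Algebra.Generated_Groups"
begin

text \<open>
  Let $X$ be an abelian surface with $\mathrm{NS}(X) = \mathbb{Z}H$ and $(H^2) = 2n$.
  A triple \<open>(r, d, a)\<close> stands for $r + dH + a\varrho_X$; integer triples form the algebraic
  Mukai lattice, complex triples its complexification. The surface enters only through \<open>n\<close>.
\<close>

type_synonym 'a mukai = "'a \<times> 'a \<times> 'a"

text \<open>$(x_1, y_1) = d_x d_y (H^2) = 2 n\, d_x d_y$.\<close>

definition mukai_pairing :: "int \<Rightarrow> 'a::comm_ring_1 mukai \<Rightarrow> 'a mukai \<Rightarrow> 'a" where
  "mukai_pairing n = (\<lambda>(x0, x1, x2) (y0, y1, y2).
     2 * of_int n * x1 * y1 - (x0 * y2 + x2 * y0))"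

definition of_mukai :: "int mukai \<Rightarrow> 'a::comm_ring_1 mukai" where
  "of_mukai = (\<lambda>(r, d, a). (of_int r, of_int d, of_int a))"

definition mukai_v :: "int \<Rightarrow> int mukai" where
  "mukai_v l = (1, 0, - l)"

text \<open>$e^{zH} = 1 + zH + \frac{z^2 (H^2)}{2}\varrho_X$, used with $z = s + \sqrt{-1}\,t$.\<close>

definition mukai_exp :: "int \<Rightarrow> complex \<Rightarrow> complex mukai" where
  "mukai_exp n z = (1, z, of_int n * z\<^sup>2)"

definition central_charge :: "int \<Rightarrow> real \<times> real \<Rightarrow> int mukai \<Rightarrow> complex" where
  "central_charge n = (\<lambda>(s, t) w. mukai_pairing n (mukai_exp n (Complex s t)) (of_mukai w))"

definition st_plane :: "(real \<times> real) set" where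
  "st_plane = {(s, t). t > 0}"

text \<open>Here \<^term>\<open>span {z}\<close> is the real line $\mathbb{R}z$ in the complex plane.\<close>

definition wall_locus :: "int \<Rightarrow> int mukai \<Rightarrow> int mukai \<Rightarrow> (real \<times> real) set" where
  "wall_locus n v w =
     {\<sigma> \<in> st_plane. span {central_charge n \<sigma> w} = span {central_charge n \<sigma> v}}"

definition rat_multiples :: "int mukai \<Rightarrow> int mukai set" where
  "rat_multiples = (\<lambda>(r, d, a). {(r', d', a'). \<exists>c::rat.
     of_int r' = c * of_int r \<and> of_int d' = c * of_int d \<and> of_int a' = c * of_int a})"

definition wall_vectors :: "int \<Rightarrow> int mukai \<Rightarrow> int mukai set" where
  "wall_vectors n v = {w. w \<notin> rat_multiples v \<and> mukai_pairing n w w \<ge> 0 \<and>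
     mukai_pairing n (v - w) (v - w) \<ge> 0 \<and> mukai_pairing n w (v - w) > 0}"

definition walls :: "int \<Rightarrow> int mukai \<Rightarrow> (real \<times> real) set set" where
  "walls n v = wall_locus n v ` wall_vectors n v - {{}}"

definition mat2 :: "real \<Rightarrow> real \<Rightarrow> real \<Rightarrow> real \<Rightarrow> real^2^2" where
  "mat2 a b c d = vector [vector [a, b], vector [c, d]]"

definition mukai_matrix :: "int \<Rightarrow> int mukai \<Rightarrow> real^2^2" where
  "mukai_matrix n = (\<lambda>(r, d, a).
     mat2 (of_int r) (of_int d * sqrt (of_int n)) (of_int d * sqrt (of_int n)) (of_int a))"

definition G_hat :: "int \<Rightarrow> (real^2^2) set" where
  "G_hat n = {mat2 (of_int a * sqrt (of_int r)) (of_int b * sqrt (of_int s'))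
                   (of_int c * sqrt (of_int s')) (of_int d * sqrt (of_int r)) | a b c d r s'.
     r > 0 \<and> s' > 0 \<and> r * s' = n \<and> (a * d * r - b * c * s' = 1 \<or> a * d * r - b * c * s' = - 1)}"

text \<open>
  The action of \<open>G_hat\<close> on integral vectors. The description is proper for \<open>n > 0\<close> and
  \<open>g \<in> G_hat n\<close>: see \<open>mukai_matrix_act\<close> below.
\<close>

definition mukai_act :: "int \<Rightarrow> int mukai \<Rightarrow> real^2^2 \<Rightarrow> int mukai" where
  "mukai_act n w g = (THE w'. mukai_matrix n w' = transpose g ** mukai_matrix n w ** g)"

definition G_group :: "int \<Rightarrow> int \<Rightarrow> (real^2^2) set" where
  "G_group n l = {g \<in> G_hat n.
     transpose g ** mat2 1 0 0 (- of_int l) ** g = mat2 1 0 0 (- of_int l) \<or>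
     transpose g ** mat2 1 0 0 (- of_int l) ** g = - mat2 1 0 0 (- of_int l)}"

text \<open>
  \<open>g\<close> sends the wall of \<open>w\<close> to the wall of \<open>w \<cdot> g\<close>. A wall has many defining vectors;
  all of them are required to give the same image.
\<close>

definition sends_wall ::
  "int \<Rightarrow> int mukai \<Rightarrow> real^2^2 \<Rightarrow> (real \<times> real) set \<Rightarrow> (real \<times> real) set \<Rightarrow> bool" where
  "sends_wall n v g W W' \<longleftrightarrow> W \<in> walls n v \<and>
     (\<forall>w \<in> wall_vectors n v. wall_locus n v w = W \<longrightarrow> wall_locus n v (mukai_act n w g) = W')"

text \<open>Pitfall: \<open>*\<close> on \<^typ>\<open>real^2^2\<close> is the entrywise product, so the group uses \<open>**\<close>.\<close>

definition S_group :: "int \<Rightarrow> int \<Rightarrow> (real^2^2) monoid" where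
  "S_group n l =
     \<lparr>carrier = {mat2 y (of_int l * x) x y | x y. \<exists>a b r s' :: int.
        x = of_int a * sqrt (of_int r) \<and> y = of_int b * sqrt (of_int s') \<and>
        r > 0 \<and> s' > 0 \<and> r * s' = n \<and>
        (y\<^sup>2 - of_int l * x\<^sup>2 = 1 \<or> y\<^sup>2 - of_int l * x\<^sup>2 = - 1)},
      mult = (**), one = mat 1\<rparr>"

definition generates_S_mod_pm1 :: "int \<Rightarrow> int \<Rightarrow> real^2^2 \<Rightarrow> bool" where
  "generates_S_mod_pm1 n l g \<longleftrightarrow>
     g \<in> carrier (S_group n l) \<and>
     generate (S_group n l Mod {mat 1, - mat 1}) {{mat 1, - mat 1} #>\<^bsub>S_group n l\<^esub> g}
       = carrier (S_group n l Mod {mat 1, - mat 1})"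

definition wall_C0 :: "(real \<times> real) set" where
  "wall_C0 = {(s, t) \<in> st_plane. s = 0}"

definition wall_Cm1 :: "int \<Rightarrow> int \<Rightarrow> real \<Rightarrow> real \<Rightarrow> (real \<times> real) set" where
  "wall_Cm1 n l p q = {(s, t) \<in> st_plane.
     (s + q / (p * sqrt (of_int n))) * (s + of_int l * p / (q * sqrt (of_int n))) + t\<^sup>2 = 0}"

text \<open>
  \<open>W\<close> is a semicircle centred on the \<open>s\<close>-axis and \<open>C\<close> lies in the open disc it bounds;
  the metric on \<^typ>\<open>real \<times> real\<close> is the Euclidean one.
\<close>

definition surrounds :: "(real \<times> real) set \<Rightarrow> (real \<times> real) set \<Rightarrow> bool" where
  "surrounds W C \<longleftrightarrow> (\<exists>c \<rho>. W = sphere (c, 0) \<rho> \<inter> st_plane \<and> C \<subseteq> ball (c, 0) \<rho>)"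

definition walls_between :: "int \<Rightarrow> int \<Rightarrow> real \<Rightarrow> real \<Rightarrow> (real \<times> real) set set" where
  "walls_between n l p q = {W \<in> walls n (mukai_v l).
     (\<forall>(s, t) \<in> W. s < 0) \<and> surrounds W (wall_Cm1 n l p q)}"

lemma mat2_mult: "mat2 a b c d ** mat2 a' b' c' d'
    = mat2 (a*a' + b*c') (a*b' + b*d') (c*a' + d*c') (c*b' + d*d')"
  by (simp add: mat2_def matrix_matrix_mult_def vec_eq_iff forall_2 sum_2 vector_2)

lemma transpose_mat2: "transpose (mat2 a b c d) = mat2 a c b d"
  by (simp add: mat2_def transpose_def vec_eq_iff forall_2 vector_2)

lemma mat2_eq_iff:
  "mat2 a b c d = mat2 a' b' c' d' \<longleftrightarrow> a = a' \<and> b = b' \<and> c = c' \<and> d = d'"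
  by (auto simp: mat2_def vec_eq_iff forall_2 vector_2)

lemma mukai_matrix_act:
  assumes n: "n > 0" and g: "g \<in> G_hat n"
  shows "mukai_matrix n (mukai_act n w g) = transpose g ** mukai_matrix n w ** g"
proof -
  obtain x y z where w: "w = (x, y, z)" by (cases w) auto
  obtain a b c d r k where gd: "g = mat2 (of_int a * sqrt (of_int r)) (of_int b * sqrt (of_int k))
                   (of_int c * sqrt (of_int k)) (of_int d * sqrt (of_int r))"
    and rs: "r > 0" "k > 0" "r * k = n" using g unfolding G_hat_def by blast
  define R S where "R = sqrt (of_int r)" and "S = sqrt (of_int k)"
  have R: "R * R = of_int r" and S: "S * S = of_int k" using rs by (auto simp: R_def S_def)
  have N: "sqrt (of_int n) = R * S"
    using rs by (simp add: R_def S_def real_sqrt_mult flip: rs(3))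
  let ?w = "(a*a*r*x + 2*a*c*n*y + c*c*k*z, a*b*x + (a*d*r + b*c*k)*y + c*d*z,
             b*b*k*x + 2*b*d*n*y + d*d*r*z)"
  have n': "of_int n = (R*R)*(S*S :: real)" unfolding R S by (simp flip: rs(3))
  have ex: "mukai_matrix n ?w = transpose g ** mukai_matrix n w ** g"
    unfolding w gd mukai_matrix_def transpose_mat2 prod.case mat2_mult mat2_eq_iff N
      R_def[symmetric] S_def[symmetric]
    by (simp only: of_int_add of_int_mult of_int_numeral n' R[symmetric] S[symmetric])
      (simp only: algebra_simps, simp)
  have "w' = ?w" if "mukai_matrix n w' = mukai_matrix n ?w" for w'
  proof -
    obtain x' y' z' where w': "w' = (x', y', z')" by (cases w') auto
    have "sqrt (of_int n) \<noteq> (0::real)" using n by simp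
    then show ?thesis
      using that unfolding w' mukai_matrix_def prod.case mat2_eq_iff
      by (simp only: mult_cancel_right of_int_eq_iff prod.inject simp_thms)
  qed
  then have "mukai_act n w g = ?w"
    unfolding mukai_act_def ex[symmetric] by (intro the_equality) auto
  then show ?thesis by (simp only: ex)
qed

end

theory Submission
  imports Defs
begin

text \<open>
  The wall of \<open>w = (r, d, a)\<close> is the locus \<open>d (n (s\<^sup>2 + t\<^sup>2) + l) = e s\<close> with \<open>e = a + r l\<close>, so it only
  depends on the ratio \<open>e : d\<close>. It is nonempty iff \<open>e\<^sup>2 - 4 n l d\<^sup>2 > 0\<close>, and the numerical conditions
  on \<open>w\<close> bound this discriminant by \<open>l\<^sup>2\<close>. A wall surrounding \<open>C\<^sub>-\<^sub>1\<close> satisfies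
  \<open>(e/d)\<^sup>2 > 4 n l + \<delta>\<close> with a fixed \<open>\<delta> > 0\<close>, so only finitely many \<open>(d, e)\<close> occur.

  For the second part put \<open>D = d \<surd>n\<close>. The matrix in \<open>S_group\<close> given by \<open>(x, y)\<close>
  multiplies \<open>e \<plusminus> 2\<surd>l D\<close> by \<open>(y \<plusminus> x\<surd>l)\<^sup>2\<close>. Hence
  \<open>\<mu> = (e + 2\<surd>l D) / (e - 2\<surd>l D) > 0\<close> is multiplied by \<open>(y + x\<surd>l)\<^sup>4\<close>. It equals \<open>1\<close> on \<open>C\<^sub>0\<close> and
  \<open>(q + p\<surd>l)\<^sup>-\<^sup>4\<close> on \<open>C\<^sub>-\<^sub>1\<close>, so a power of the generator moves every wall into the fundamental
  interval between these two values.
\<close>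

definition pencil_circle :: "real \<Rightarrow> real \<Rightarrow> (real \<times> real) set" where
  "pencil_circle k c = {(s, t). t > 0 \<and> s\<^sup>2 + t\<^sup>2 - 2 * c * s + k = 0}"

definition pencil_locus :: "int \<Rightarrow> int \<Rightarrow> int \<Rightarrow> int \<Rightarrow> (real \<times> real) set" where
  "pencil_locus n l d e =
     {(s, t). t > 0 \<and> d * (n * (s\<^sup>2 + t\<^sup>2) + l) = e * s}"

lemma span_singleton_scaleR:
  fixes w :: "'a::real_vector"
  assumes "k \<noteq> 0"
  shows "span {k *\<^sub>R w} = span {w}"
proof (rule span_eq[THEN iffD2], intro conjI)
  show "{k *\<^sub>R w} \<subseteq> span {w}" by (simp add: span_mul span_base)
  have "(1 / k) *\<^sub>R (k *\<^sub>R w) \<in> span {k *\<^sub>R w}" by (intro span_mul span_base) simp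
  then show "{w} \<subseteq> span {k *\<^sub>R w}" using assms by simp
qed

lemma span_singleton_eq_iff:
  fixes z w :: complex
  assumes "z \<noteq> 0" "w \<noteq> 0"
  shows "span {z} = span {w} \<longleftrightarrow> Im (z * cnj w) = 0"
proof
  assume "span {z} = span {w}"
  then have "z \<in> span {w}" using span_base[of z "{z}"] by simp
  then obtain k where "z = k *\<^sub>R w" by (auto simp: span_singleton)
  then show "Im (z * cnj w) = 0" by (simp add: algebra_simps)
next
  assume "Im (z * cnj w) = 0"
  then obtain x where x: "z * cnj w = of_real x"
    by (metis Reals_cases complex_is_Real_iff)
  define k where "k = x / (cmod w)\<^sup>2"
  have "z * (w * cnj w) = of_real x * w" using x by (metis mult.assoc mult.commute)
  then have "z * of_real ((cmod w)\<^sup>2) = of_real x * w" by (simp only: complex_norm_square)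
  then have zk: "z = k *\<^sub>R w"
    using assms by (simp add: k_def scaleR_conv_of_real field_simps)
  then have "k \<noteq> 0" using assms by auto
  then show "span {z} = span {w}"
    unfolding zk by (rule span_singleton_scaleR)
qed

lemma wall_vectors_iff:
  "(r, d, a) \<in> wall_vectors n (mukai_v l) \<longleftrightarrow> (d \<noteq> 0 \<or> a + r * l \<noteq> 0) \<and>
     n * d\<^sup>2 - r * a \<ge> 0 \<and> l - (l * r - a) + (n * d\<^sup>2 - r * a) \<ge> 0 \<and>
     l * r - a - 2 * (n * d\<^sup>2 - r * a) > 0"
proof -
  have "(r, d, a) \<in> rat_multiples (mukai_v l) \<longleftrightarrow> d = 0 \<and> a + r * l = 0"
  proof -
    have "(of_int a :: rat) = of_int r * (- of_int l) \<longleftrightarrow> a = r * (- l)"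
      by (metis of_int_eq_iff of_int_minus of_int_mult)
    then show ?thesis by (auto simp: rat_multiples_def mukai_v_def)
  qed
  moreover have "mukai_pairing n (r, d, a) (r, d, a) = 2 * (n * d\<^sup>2 - r * a)"
    "mukai_pairing n (mukai_v l - (r, d, a)) (mukai_v l - (r, d, a))
      = 2 * (l - (l * r - a) + (n * d\<^sup>2 - r * a))"
    "mukai_pairing n (r, d, a) (mukai_v l - (r, d, a)) = l * r - a - 2 * (n * d\<^sup>2 - r * a)"
    by (simp_all add: mukai_pairing_def mukai_v_def) (simp_all add: algebra_simps power2_eq_square)
  ultimately show ?thesis unfolding wall_vectors_def mem_Collect_eq by auto
qed

lemma wall_locus_eq_pencil_locus:
  assumes n: "n > 0" and l: "l > 0" and nz: "d \<noteq> 0 \<or> a + r * l \<noteq> 0"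
    and pos: "n * d\<^sup>2 - r * a \<ge> 0"
  shows "wall_locus n (mukai_v l) (r, d, a) = pencil_locus n l d (a + r * l)"
proof -
  have "span {central_charge n (s, t) (r, d, a)} = span {central_charge n (s, t) (mukai_v l)} \<longleftrightarrow>
      d * (n * (s\<^sup>2 + t\<^sup>2) + l) = (a + r * l) * s" if t: "t > 0" for s t :: real
  proof -
    define zw zv where "zw = central_charge n (s, t) (r, d, a)"
      and "zv = central_charge n (s, t) (mukai_v l)"
    have cw: "Re zw = 2 * n * s * d - (a + r * (n * (s\<^sup>2 - t\<^sup>2)))"
             "Im zw = 2 * n * t * (d - r * s)"
      by (simp_all add: zw_def central_charge_def mukai_pairing_def mukai_exp_def of_mukai_def
          algebra_simps power2_eq_square)
    have cv: "Re zv = l - n * (s\<^sup>2 - t\<^sup>2)" "Im zv = - 2 * n * s * t"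
      by (simp_all add: zv_def central_charge_def mukai_pairing_def mukai_exp_def of_mukai_def
          mukai_v_def algebra_simps power2_eq_square)
    have "zv \<noteq> 0"
    proof
      assume "zv = 0"
      then have "s = 0" "l - n * (s\<^sup>2 - t\<^sup>2) = 0" using cv n t by auto
      moreover have "n * t\<^sup>2 > 0" using n t by simp
      ultimately show False using l by simp
    qed
    moreover have "zw \<noteq> 0"
    proof
      assume "zw = 0"
      then have d: "d = r * s" and 0: "2 * n * s * d - (a + r * (n * (s\<^sup>2 - t\<^sup>2))) = 0"
        using cw n t by auto
      have a: "a = r * n * (s\<^sup>2 + t\<^sup>2)"
        using 0 unfolding d by (simp add: algebra_simps power2_eq_square)
      have "real_of_int (n * d\<^sup>2 - r * a) \<ge> 0" using pos by linarith
      then have "n * (r * s)\<^sup>2 - r * (r * n * (s\<^sup>2 + t\<^sup>2)) \<ge> 0" using d a by simp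
      then have "n * (r * t)\<^sup>2 \<le> 0" by (simp add: algebra_simps power2_eq_square)
      then have "(r * t)\<^sup>2 \<le> 0" using n by (simp add: mult_le_0_iff)
      then have "r = 0" using t by simp
      then show False using nz d a by simp
    qed
    ultimately have "span {zw} = span {zv} \<longleftrightarrow> Im (zw * cnj zv) = 0"
      by (rule span_singleton_eq_iff[rotated])
    also have "Im (zw * cnj zv) = 2 * n * t * (d * (n * (s\<^sup>2 + t\<^sup>2) + l) - (a + r * l) * s)"
      by (simp add: cw cv) (simp add: algebra_simps power2_eq_square)
    finally show ?thesis using n t by (simp add: zw_def zv_def)
  qed
  then show ?thesis by (auto simp: wall_locus_def pencil_locus_def st_plane_def)
qed

lemma pencil_locus_zero: "n > 0 \<Longrightarrow> l > 0 \<Longrightarrow> e \<noteq> 0 \<Longrightarrow> pencil_locus n l 0 e = wall_C0"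
  by (auto simp: pencil_locus_def wall_C0_def st_plane_def)

lemma pencil_locus_eq_circle:
  assumes "n > 0" "d \<noteq> 0"
  shows "pencil_locus n l d e = pencil_circle (of_int l / of_int n) (of_int e / (2 * of_int d * of_int n))"
proof -
  have "d * (n * (s\<^sup>2 + t\<^sup>2) + l) = e * s \<longleftrightarrow> s\<^sup>2 + t\<^sup>2 - 2 * (of_int e / (2 * of_int d * of_int n)) * s + of_int l / of_int n = 0"
    for s t :: real
    using assms by (simp add: field_simps)
  then show ?thesis unfolding pencil_locus_def pencil_circle_def by blast
qed

lemma pencil_locus_cong:
  assumes "d1 \<noteq> 0 \<or> e1 \<noteq> 0" "d2 \<noteq> 0 \<or> e2 \<noteq> 0" "d1 * e2 = d2 * e1"
  shows "pencil_locus n l d1 e1 = pencil_locus n l d2 e2"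
proof -
  have *: "d2 * K = e2 * s"
    if "d1 * K = e1 * s" and "d1 \<noteq> 0 \<or> e1 \<noteq> 0" "d1 * e2 = d2 * e1"
    for K s d1 e1 d2 e2 :: real
  proof -
    have "d1 * (d2 * K) = d1 * (e2 * s)" "e1 * (d2 * K) = e1 * (e2 * s)"
      using that by algebra+
    then show ?thesis using that(2) by auto
  qed
  have "real_of_int d1 * of_int e2 = of_int d2 * of_int e1" using assms(3) by (metis of_int_mult)
  then have "d1 * K = e1 * s \<longleftrightarrow> d2 * K = e2 * s" for K s :: real
    using assms(1,2) *[of d1 K e1 s e2 d2] *[of d2 K e2 s e1 d1] unfolding of_int_eq_0_iff by argo
  then show ?thesis unfolding pencil_locus_def by (simp only:)
qed

lemma pencil_locus_determines_ratio:
  assumes "n > 0" "l > 0" "pencil_locus n l d1 e1 = pencil_locus n l d2 e2"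
    "pencil_locus n l d1 e1 \<noteq> {}"
  shows "d1 * e2 = d2 * e1"
proof -
  obtain s t where "(s, t) \<in> pencil_locus n l d1 e1" using assms(4) by auto
  then have 1: "d1 * (n * (s\<^sup>2 + t\<^sup>2) + l) = e1 * s" and 2: "d2 * (n * (s\<^sup>2 + t\<^sup>2) + l) = e2 * s"
    using assms(3) by (auto simp: pencil_locus_def)
  have "(n * (s\<^sup>2 + t\<^sup>2) + l) \<noteq> 0"
    using assms(1,2) by (smt (verit) mult_nonneg_nonneg of_int_0_less_iff zero_le_power2)
  moreover have "(of_int d1 * of_int e2) * (n * (s\<^sup>2 + t\<^sup>2) + l) = (of_int d2 * of_int e1) * (n * (s\<^sup>2 + t\<^sup>2) + l)"
    using 1 2 by algebra
  ultimately have "real_of_int (d1 * e2) = of_int (d2 * e1)" by simp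
  then show ?thesis by linarith
qed

lemma centre_sq_gt:
  assumes "n > 0" "d \<noteq> 0" "e\<^sup>2 > 4 * n * l * d\<^sup>2"
  shows "(of_int e / (2 * of_int d * of_int n))\<^sup>2 > (of_int l / of_int n :: real)"
proof -
  define c :: real where "c = of_int e / (2 * of_int d * of_int n)"
  have "real_of_int (e\<^sup>2) > real_of_int (4 * n * l * d\<^sup>2)" using assms by linarith
  moreover have "real_of_int (e\<^sup>2) = 4 * (d * real_of_int n)\<^sup>2 * c\<^sup>2"
    using assms by (simp add: c_def power_mult_distrib power_divide)
  moreover have "real_of_int (4 * n * l * d\<^sup>2) = 4 * (d * real_of_int n)\<^sup>2 * (l / n)"
    using assms by (simp add: power2_eq_square)
  ultimately have "4 * (d * real_of_int n)\<^sup>2 * (l / n) < 4 * (d * real_of_int n)\<^sup>2 * c\<^sup>2" by simp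
  then show ?thesis unfolding c_def[symmetric] by (rule mult_left_less_imp_less) simp
qed

lemma pencil_locus_nonempty_iff:
  assumes n: "n > 0" and l: "l > 0" and nz: "d \<noteq> 0 \<or> e \<noteq> 0"
  shows "pencil_locus n l d e \<noteq> {} \<longleftrightarrow> e\<^sup>2 > 4 * n * l * d\<^sup>2"
proof
  assume "pencil_locus n l d e \<noteq> {}"
  then obtain s t :: real where t: "t > 0" and eq: "d * (n * (s\<^sup>2 + t\<^sup>2) + l) = e * s"
    by (auto simp: pencil_locus_def)
  show "e\<^sup>2 > 4 * n * l * d\<^sup>2"
  proof (cases "d = 0")
    case False
    have n': "real_of_int n > 0" and l': "real_of_int l > 0" using n l by auto
    have nt: "n * t\<^sup>2 > 0" using n' t by simp
    have ns: "n * s\<^sup>2 \<ge> 0" using n' by simp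
    have K: "n * (s\<^sup>2 + t\<^sup>2) + l > n * s\<^sup>2 + l" using nt by (simp add: algebra_simps)
    have "e * s \<noteq> 0" using K ns l' False unfolding eq[symmetric] by auto
    then have s: "s \<noteq> 0" by auto
    have "4 * n * l * s\<^sup>2 \<le> (n * s\<^sup>2 + l)\<^sup>2"
      using zero_le_power2[of "n * s\<^sup>2 - real_of_int l"] by (simp add: algebra_simps power2_eq_square)
    also have "\<dots> < (n * (s\<^sup>2 + t\<^sup>2) + l)\<^sup>2"
      using K ns l' by (intro power_strict_mono) auto
    finally have "d\<^sup>2 * (4 * n * l * s\<^sup>2) < d\<^sup>2 * (n * (s\<^sup>2 + t\<^sup>2) + l)\<^sup>2"
      using False by (intro mult_strict_left_mono) auto
    also have "\<dots> = e\<^sup>2 * s\<^sup>2" using arg_cong[OF eq, of "\<lambda>x. x\<^sup>2"] by (simp only: power_mult_distrib of_int_power)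
    finally have "real_of_int (4 * n * l * d\<^sup>2) * s\<^sup>2 < real_of_int (e\<^sup>2) * s\<^sup>2" by (simp add: algebra_simps)
    then have "real_of_int (4 * n * l * d\<^sup>2) < real_of_int (e\<^sup>2)"
      by (rule mult_right_less_imp_less) simp
    then show ?thesis by linarith
  qed (use nz in simp)
next
  assume gt: "e\<^sup>2 > 4 * n * l * d\<^sup>2"
  show "pencil_locus n l d e \<noteq> {}"
  proof (cases "d = 0")
    case True
    then have "(0, 1) \<in> pencil_locus n l d e" by (simp add: pencil_locus_def)
    then show ?thesis by blast
  next
    case False
    define c :: real where "c = of_int e / (2 * of_int d * of_int n)"
    have "c\<^sup>2 > l / n" using centre_sq_gt[OF n False gt] by (simp add: c_def)
    then have "(c, sqrt (c\<^sup>2 - l / n)) \<in> pencil_circle (l / n) c"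
      by (simp add: pencil_circle_def power2_eq_square)
    then show ?thesis using pencil_locus_eq_circle[OF n False] by (auto simp: c_def)
  qed
qed

lemma pencil_circle_eq_sphereD:
  assumes "c\<^sup>2 > k" and eq: "pencil_circle k c = sphere (c', 0) \<rho> \<inter> st_plane"
  shows "c' = c" "\<rho> > 0" "\<rho>\<^sup>2 = c\<^sup>2 - k"
proof -
  define R where "R = sqrt (c\<^sup>2 - k)"
  have R: "R > 0" "R\<^sup>2 = c\<^sup>2 - k" using assms(1) by (auto simp: R_def)
  have sph: "(s - c')\<^sup>2 + t\<^sup>2 = \<rho>\<^sup>2 \<and> \<rho> \<ge> 0" if "(s, t) \<in> pencil_circle k c" for s t
  proof -
    have "dist (c', 0) (s, t) = \<rho>" using that unfolding eq by (simp add: sphere_def)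
    then have d: "sqrt ((c' - s)\<^sup>2 + t\<^sup>2) = \<rho>"
      by (simp add: dist_Pair_Pair dist_real_def)
    show ?thesis unfolding d[symmetric] by (simp add: power2_commute)
  qed
  have on: "(c + x * R, y * R) \<in> pencil_circle k c" if "x\<^sup>2 + y\<^sup>2 = 1" "y > 0" for x y
  proof -
    have "(c + x * R)\<^sup>2 + (y * R)\<^sup>2 - 2 * c * (c + x * R) + k = (x\<^sup>2 + y\<^sup>2) * R\<^sup>2 - c\<^sup>2 + k"
      by (simp add: algebra_simps power2_eq_square)
    then show ?thesis using that R by (simp add: pencil_circle_def)
  qed
  have "(c + 3 / 5 * R - c')\<^sup>2 + (4 / 5 * R)\<^sup>2 = \<rho>\<^sup>2"
    using sph[OF on[of "3/5" "4/5"]] by (simp add: power2_eq_square)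
  moreover have "(c - 3 / 5 * R - c')\<^sup>2 + (4 / 5 * R)\<^sup>2 = \<rho>\<^sup>2"
    using sph[OF on[of "-3/5" "4/5"]] by (simp add: power2_eq_square)
  ultimately have "(12 / 5) * ((c - c') * R) = 0" by algebra
  then show c: "c' = c" using R by simp
  show r: "\<rho>\<^sup>2 = c\<^sup>2 - k" using sph[OF on[of 0 1]] c R by simp
  have "\<rho> \<ge> 0" using sph[OF on[of 0 1]] by simp
  then show "\<rho> > 0" using r assms(1) by (cases "\<rho> = 0") auto
qed

lemma surrounds_pencil_circle_iff:
  assumes "k > 0" "c\<^sup>2 > k" "c1\<^sup>2 > k" "c1 < 0"
  shows "surrounds (pencil_circle k c) (pencil_circle k c1) \<longleftrightarrow> c < c1"
proof
  assume "surrounds (pencil_circle k c) (pencil_circle k c1)"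
  then obtain c' \<rho> where eq: "pencil_circle k c = sphere (c', 0) \<rho> \<inter> st_plane"
    and sub: "pencil_circle k c1 \<subseteq> ball (c', 0) \<rho>" unfolding surrounds_def by blast
  note c = pencil_circle_eq_sphereD[OF assms(2) eq]
  have "(c1, sqrt (c1\<^sup>2 - k)) \<in> pencil_circle k c1"
    using assms by (simp add: pencil_circle_def power2_eq_square)
  then have "dist (c, 0) (c1, sqrt (c1\<^sup>2 - k)) < \<rho>" using sub c by auto
  then have "sqrt ((c - c1)\<^sup>2 + (c1\<^sup>2 - k)) < \<rho>"
    using assms by (simp add: dist_Pair_Pair dist_real_def)
  then have "(c - c1)\<^sup>2 + (c1\<^sup>2 - k) < \<rho>\<^sup>2"
    using c(2) by (metis abs_of_pos real_sqrt_abs real_sqrt_less_iff)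
  then have "c1 * (c1 - c) < 0" using c by (simp add: algebra_simps power2_eq_square)
  then show "c < c1" using assms(4) by (simp add: mult_less_0_iff)
next
  assume lt: "c < c1"
  define R where "R = sqrt (c\<^sup>2 - k)"
  have R: "R > 0" "R\<^sup>2 = c\<^sup>2 - k" using assms by (auto simp: R_def)
  have dist: "dist (c, 0) (s, t) = sqrt ((s - c)\<^sup>2 + t\<^sup>2)" for s t :: real
    by (simp add: dist_Pair_Pair dist_real_def power2_commute)
  have "pencil_circle k c = sphere (c, 0) R \<inter> st_plane"
    by (auto simp: pencil_circle_def st_plane_def dist R_def algebra_simps power2_eq_square)
  moreover have "pencil_circle k c1 \<subseteq> ball (c, 0) R"
  proof clarify
    fix s t assume "(s, t) \<in> pencil_circle k c1"
    then have eq: "s\<^sup>2 + t\<^sup>2 = 2 * c1 * s - k" and t: "t > 0" by (auto simp: pencil_circle_def)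
    have "2 * c1 * s > 0" using eq assms(1) t by (smt (verit) zero_le_power2)
    then have "s < 0" using assms(4) by (simp add: zero_less_mult_iff)
    then have "(c1 - c) * s < 0" using lt by (simp add: mult_pos_neg)
    then have "(s - c)\<^sup>2 + t\<^sup>2 < c\<^sup>2 - k" using eq by (simp add: algebra_simps power2_eq_square)
    then show "(s, t) \<in> ball (c, 0) R" by (simp add: dist R_def)
  qed
  ultimately show "surrounds (pencil_circle k c) (pencil_circle k c1)" unfolding surrounds_def by blast
qed

definition centre_Cm1 :: "int \<Rightarrow> int \<Rightarrow> real \<Rightarrow> real \<Rightarrow> real" where
  "centre_Cm1 n l p q = - ((q\<^sup>2 + l * p\<^sup>2) / (2 * p * q * sqrt n))"

lemma wall_Cm1_eq_circle:
  assumes "n > 0" "p > 0" "q > 0"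
  shows "wall_Cm1 n l p q = pencil_circle (l / n) (centre_Cm1 n l p q)"
proof -
  define N where "N = sqrt n"
  have N: "N > 0" "N\<^sup>2 = real_of_int n" using assms by (auto simp: N_def)
  have "(s + q / (p * N)) * (s + l * p / (q * N)) + t\<^sup>2
      = s\<^sup>2 + t\<^sup>2 - 2 * (- ((q\<^sup>2 + l * p\<^sup>2) / (2 * p * q * N))) * s + l / n" for s t
    unfolding N(2)[symmetric] using N(1) assms by (simp add: divide_simps) (simp add: algebra_simps power2_eq_square)
  note eq = this
  show ?thesis
    unfolding wall_Cm1_def pencil_circle_def st_plane_def centre_Cm1_def N_def[symmetric] eq by auto
qed

definition norm_unit :: "int \<Rightarrow> int \<Rightarrow> real \<Rightarrow> real \<Rightarrow> bool" where
  "norm_unit n l x y \<longleftrightarrow> (\<exists>a b r s' :: int.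
     x = of_int a * sqrt (of_int r) \<and> y = of_int b * sqrt (of_int s') \<and> r > 0 \<and> s' > 0 \<and> r * s' = n \<and>
     (y\<^sup>2 - l * x\<^sup>2 = 1 \<or> y\<^sup>2 - l * x\<^sup>2 = - 1))"

lemma mat2_mem_S_group_iff:
  "mat2 y (l * x) x y \<in> carrier (S_group n l) \<longleftrightarrow> norm_unit n l x y"
  by (auto simp: S_group_def norm_unit_def mat2_eq_iff)

lemma norm_unit_norm: "norm_unit n l x y \<Longrightarrow> y\<^sup>2 - l * x\<^sup>2 = 1 \<or> y\<^sup>2 - l * x\<^sup>2 = - 1"
  by (auto simp: norm_unit_def)

lemma norm_unit_uminus: "norm_unit n l x y \<Longrightarrow> norm_unit n l (- x) y"
proof -
  assume "norm_unit n l x y"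
  then obtain a b r s' :: int where "x = a * sqrt r" "y = b * sqrt s'" "r > 0" "s' > 0" "r * s' = n"
     "y\<^sup>2 - l * x\<^sup>2 = 1 \<or> y\<^sup>2 - l * x\<^sup>2 = - 1" unfolding norm_unit_def by blast
  then show ?thesis unfolding norm_unit_def
    by (intro exI[of _ "- a"] exI[of _ b] exI[of _ r] exI[of _ s']) simp
qed

lemma norm_unit_mat2_mem_G_group:
  assumes "norm_unit n l x y"
  shows "mat2 y (l * x) x y \<in> G_group n l"
proof -
  obtain a b r s' :: int where x: "x = a * sqrt r" and y: "y = b * sqrt s'"
    and rs: "r > 0" "s' > 0" "r * s' = n"
    and nu: "y\<^sup>2 - l * x\<^sup>2 = 1 \<or> y\<^sup>2 - l * x\<^sup>2 = - 1" using assms unfolding norm_unit_def by blast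
  have "y\<^sup>2 - l * x\<^sup>2 = real_of_int (b * b * s' - (l * a) * a * r)"
    using rs by (simp add: x y power_mult_distrib) (simp add: power2_eq_square)
  then have "real_of_int (b * b * s' - (l * a) * a * r) = real_of_int 1
      \<or> real_of_int (b * b * s' - (l * a) * a * r) = real_of_int (- 1)"
    using nu by simp
  then have "b * b * s' - (l * a) * a * r = 1 \<or> b * b * s' - (l * a) * a * r = - 1"
    unfolding of_int_eq_iff .
  moreover have "mat2 y (l * x) x y = mat2 (of_int b * sqrt (of_int s')) (of_int (l * a) * sqrt (of_int r))
     (of_int a * sqrt (of_int r)) (of_int b * sqrt (of_int s'))" by (simp add: x y mult.assoc)
  moreover have "s' * r = n" using rs by (simp add: mult.commute)
  ultimately have "mat2 y (l * x) x y \<in> G_hat n" unfolding G_hat_def using rs by blast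
  moreover have neg: "- mat2 1 0 0 (- of_int l) = mat2 (- 1) 0 0 (of_int l)"
    by (simp add: mat2_def vec_eq_iff forall_2 vector_2)
  have "transpose (mat2 y (l * x) x y) ** mat2 1 0 0 (- of_int l) ** mat2 y (l * x) x y
      = mat2 (y\<^sup>2 - l * x\<^sup>2) 0 0 (- of_int l * (y\<^sup>2 - l * x\<^sup>2))"
    unfolding transpose_mat2 mat2_mult mat2_eq_iff by (simp add: algebra_simps power2_eq_square)
  ultimately show ?thesis using nu unfolding G_group_def neg by auto
qed

text \<open>Even powers of \<open>q + p\<surd>l\<close> have \<open>x \<in> \<surd>n \<int>\<close>, \<open>y \<in> \<int>\<close>; odd powers have the same
  square roots as \<open>p, q\<close>.\<close>

lemma norm_unit_power:
  assumes "norm_unit n l p q" and l: "l > 0"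
  shows "\<exists>x y. norm_unit n l x y \<and> y + sqrt l * x = (q + sqrt l * p) ^ k
    \<and> y - sqrt l * x = (q - sqrt l * p) ^ k"
proof -
  obtain a b r s' :: int where p: "p = a * sqrt r" and q: "q = b * sqrt s'"
    and rs: "r > 0" "s' > 0" "r * s' = n"
    and nu: "q\<^sup>2 - l * p\<^sup>2 = 1 \<or> q\<^sup>2 - l * p\<^sup>2 = - 1" using assms unfolding norm_unit_def by blast
  define R S L where "R = sqrt r" and "S = sqrt s'" and "L = sqrt l"
  have RS: "R * R = r" "S * S = s'" "sqrt n = R * S" "L * L = l"
    using rs l by (simp_all add: R_def S_def L_def real_sqrt_mult flip: rs(3))
  note pq = p[folded R_def] q[folded S_def]
  have "\<exists>(c :: int) (d :: int) (x :: real) (y :: real). x = c * (if even k then sqrt n else R) \<and> y = d * (if even k then 1 else S) \<and>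
      y + L * x = (q + L * p) ^ k \<and> y - L * x = (q - L * p) ^ k"
  proof (induction k)
    case 0
    show ?case by (intro exI[of _ 0] exI[of _ 1]) simp
  next
    case (Suc k)
    then obtain c d :: int and x y :: real where x: "x = c * (if even k then sqrt n else R)"
      and y: "y = d * (if even k then 1 else S)"
      and k: "y + L * x = (q + L * p) ^ k" "y - L * x = (q - L * p) ^ k" by blast
    define x' y' where "x' = x * q + y * p" and "y' = y * q + l * x * p"
    have "y' + L * x' = (q + L * p) ^ Suc k" "y' - L * x' = (q - L * p) ^ Suc k"
      unfolding power_Suc k[symmetric] x'_def y'_def RS(4)[symmetric] by algebra+
    moreover have "\<exists>(c :: int) (d :: int). x' = c * (if even (Suc k) then sqrt n else R)
        \<and> y' = d * (if even (Suc k) then 1 else S)"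
    proof (cases "even k")
      case True
      then have "x' = (c * b * s' + d * a) * R" "y' = (d * b + l * c * a * r) * S"
        unfolding x'_def y'_def x y pq RS(3) of_int_add of_int_mult RS(1,2)[symmetric]
        by (simp_all add: algebra_simps)
      then have "x' = real_of_int (c * b * s' + d * a) * R" "y' = real_of_int (d * b + l * c * a * r) * S"
        by simp_all
      then show ?thesis using True by (auto simp del: of_int_add of_int_mult)
    next
      case False
      then have "x' = (c * b + d * a) * sqrt n" "y' = d * b * s' + l * c * a * r"
        unfolding x'_def y'_def x y pq RS(3) of_int_add of_int_mult RS(1,2)[symmetric]
        by (simp_all add: algebra_simps)
      then have "x' = real_of_int (c * b + d * a) * sqrt n" "y' = real_of_int (d * b * s' + l * c * a * r)"
        by simp_all
      then show ?thesis using False by (auto simp del: of_int_add of_int_mult)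
    qed
    ultimately show ?case by blast
  qed
  then obtain c d :: int and x y :: real where x: "x = c * (if even k then sqrt n else R)"
      and y: "y = d * (if even k then 1 else S)"
      and k: "y + L * x = (q + L * p) ^ k" "y - L * x = (q - L * p) ^ k" by blast
  have "y\<^sup>2 - l * x\<^sup>2 = (y + L * x) * (y - L * x)"
    by (simp add: algebra_simps power2_eq_square RS(4)[symmetric])
  also have "\<dots> = ((q + L * p) * (q - L * p)) ^ k" by (simp only: k power_mult_distrib)
  also have "(q + L * p) * (q - L * p) = q\<^sup>2 - l * p\<^sup>2"
    by (simp add: algebra_simps power2_eq_square RS(4)[symmetric])
  finally have "y\<^sup>2 - l * x\<^sup>2 = 1 \<or> y\<^sup>2 - l * x\<^sup>2 = - 1"
    using nu by (cases "even k") auto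
  moreover have "\<exists>(r :: int) (s' :: int). x = c * sqrt r \<and> y = d * sqrt s' \<and> r > 0 \<and> s' > 0 \<and> r * s' = n"
  proof (cases "even k")
    case True
    then show ?thesis using x y rs by (intro exI[of _ n] exI[of _ 1]) auto
  next
    case False
    then show ?thesis using x y rs by (intro exI[of _ r] exI[of _ s']) (auto simp: R_def S_def)
  qed
  ultimately have "norm_unit n l x y" unfolding norm_unit_def by blast
  then show ?thesis using k unfolding L_def by blast
qed

lemma norm_unit_powi:
  assumes nu: "norm_unit n l p q" and l: "l > 0"
  obtains x y where "norm_unit n l x y" "(y + sqrt l * x)\<^sup>2 = ((q + sqrt l * p)\<^sup>2) powi k"
proof (cases "k \<ge> 0")
  case True
  obtain x y where "norm_unit n l x y" "y + sqrt l * x = (q + sqrt l * p) ^ nat k"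
    using norm_unit_power[OF assms] by blast
  then show ?thesis using True that[of x y]
    by (simp add: power_int_def power_mult[symmetric] mult.commute)
next
  case False
  obtain x y where xy: "norm_unit n l x y" "y - sqrt l * x = (q - sqrt l * p) ^ nat (- k)"
    using norm_unit_power[OF assms] by blast
  have "(q + sqrt l * p)\<^sup>2 * (q - sqrt l * p)\<^sup>2 = (q\<^sup>2 - (sqrt l)\<^sup>2 * p\<^sup>2)\<^sup>2" by algebra
  also have "\<dots> = 1" using norm_unit_norm[OF nu] l by auto
  finally have 1: "(q - sqrt l * p)\<^sup>2 = inverse ((q + sqrt l * p)\<^sup>2)"
    by (metis inverse_unique)
  have "(y + sqrt l * - x)\<^sup>2 = ((q - sqrt l * p)\<^sup>2) ^ nat (- k)"
    using xy(2) by (simp add: power_mult[symmetric] mult.commute)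
  also have "\<dots> = ((q + sqrt l * p)\<^sup>2) powi k" unfolding 1 using False by (simp add: power_int_def)
  finally show ?thesis using that norm_unit_uminus[OF xy(1)] by blast
qed

lemma mukai_act_norm_unit:
  assumes n: "n > 0" and nu: "norm_unit n l x y"
  obtains r' d' a' where "mukai_act n (r, d, a) (mat2 y (l * x) x y) = (r', d', a')"
    "d' * sqrt n = of_int (a + r * l) * (x * y) + d * sqrt n * (y\<^sup>2 + l * x\<^sup>2)"
    "of_int (a' + r' * l) = of_int (a + r * l) * (y\<^sup>2 + l * x\<^sup>2) + 4 * of_int l * (x * y) * (d * sqrt n)"
    "n * d'\<^sup>2 - r' * a' = n * d\<^sup>2 - r * a"
    "l * r' - a' = l * r - a \<or> l * r' - a' = - (l * r - a)"
proof -
  define N where "N = sqrt n"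
  have N: "N * N = n" using n by (simp add: N_def)
  obtain r' d' a' where act: "mukai_act n (r, d, a) (mat2 y (l * x) x y) = (r', d', a')"
    by (metis surj_pair)
  have g: "mat2 y (l * x) x y \<in> G_hat n"
    using norm_unit_mat2_mem_G_group[OF nu] by (simp add: G_group_def)
  have eqs: "r' = y * (r * y + d * N * x) + x * (d * N * y + a * x)"
    "d' * N = y * (r * (l * x) + d * N * y) + x * (d * N * (l * x) + a * y)"
    "a' = l * x * (r * (l * x) + d * N * y) + y * (d * N * (l * x) + a * y)"
    using mukai_matrix_act[OF n g, of "(r, d, a)"]
    unfolding act mukai_matrix_def prod.case transpose_mat2 mat2_mult mat2_eq_iff N_def[symmetric]
    by (simp_all add: algebra_simps)
  have sq: "(y\<^sup>2 - l * x\<^sup>2)\<^sup>2 = 1" using norm_unit_norm[OF nu] by auto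
  have "real_of_int n * (of_int d')\<^sup>2 - of_int r' * of_int a' = (d' * N)\<^sup>2 - of_int r' * of_int a'"
    unfolding N[symmetric] by algebra
  also have "\<dots> = (of_int n * (of_int d)\<^sup>2 - of_int r * of_int a) * (y\<^sup>2 - l * x\<^sup>2)\<^sup>2"
    unfolding eqs(1,3) unfolding eqs(2) N[symmetric] by algebra
  finally have "real_of_int (n * d'\<^sup>2 - r' * a') = real_of_int (n * d\<^sup>2 - r * a)" unfolding sq by simp
  then have 4: "n * d'\<^sup>2 - r' * a' = n * d\<^sup>2 - r * a" unfolding of_int_eq_iff .
  have "real_of_int (l * r' - a') = (of_int l * of_int r - of_int a) * (y\<^sup>2 - l * x\<^sup>2)"
    unfolding of_int_diff of_int_mult unfolding eqs(1,3) by algebra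
  then have "real_of_int (l * r' - a') = of_int l * of_int r - of_int a
      \<or> real_of_int (l * r' - a') = - (of_int l * of_int r - of_int a)"
    using norm_unit_norm[OF nu] by auto
  then have "real_of_int (l * r' - a') = real_of_int (l * r - a)
      \<or> real_of_int (l * r' - a') = real_of_int (- (l * r - a))" by simp
  then have 5: "l * r' - a' = l * r - a \<or> l * r' - a' = - (l * r - a)" unfolding of_int_eq_iff .
  have 2: "d' * sqrt n = of_int (a + r * l) * (x * y) + d * sqrt n * (y\<^sup>2 + l * x\<^sup>2)"
    using eqs(2) unfolding N_def by (simp add: algebra_simps power2_eq_square)
  have 3: "of_int (a' + r' * l) = of_int (a + r * l) * (y\<^sup>2 + l * x\<^sup>2) + 4 * of_int l * (x * y) * (d * sqrt n)"
    unfolding of_int_add of_int_mult unfolding eqs(1,3) unfolding N_def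
    by (simp add: algebra_simps power2_eq_square)
  show ?thesis using that[OF act 2 3 4 5] .
qed

lemma centre_Cm1_neg:
  assumes "n > 0" "l > 0" "p > 0" "q > 0"
  shows "centre_Cm1 n l p q < 0"
proof -
  have "q\<^sup>2 + l * p\<^sup>2 > 0" using assms by (intro add_nonneg_pos) auto
  then have "(q\<^sup>2 + l * p\<^sup>2) / (2 * p * q * sqrt n) > 0" using assms by (intro divide_pos_pos) auto
  then show ?thesis by (simp only: centre_Cm1_def neg_less_0_iff_less)
qed

lemma centre_Cm1_sq:
  assumes "n > 0" "p > 0" "q > 0" "norm_unit n l p q"
  shows "(centre_Cm1 n l p q)\<^sup>2 = l / n + 1 / (4 * p\<^sup>2 * q\<^sup>2 * n)"
proof -
  have "(q\<^sup>2 - l * p\<^sup>2)\<^sup>2 = 1" using norm_unit_norm[OF assms(4)] by auto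
  then have "(q\<^sup>2 + l * p\<^sup>2)\<^sup>2 = 4 * of_int l * p\<^sup>2 * q\<^sup>2 + 1" by algebra
  then show ?thesis using assms(1-3)
    by (simp add: centre_Cm1_def power_divide power_mult_distrib) (simp add: field_simps)
qed

lemma finite_walls_between:
  assumes n: "n > 0" and l: "l > 0" and p: "p > 0" and q: "q > 0"
    and nu: "norm_unit n l p q"
  shows "finite (walls_between n l p q)"
proof -
  define c1 where "c1 = centre_Cm1 n l p q"
  have n': "real_of_int n \<ge> 1" using n by auto
  have c1: "c1 < 0" using n l p q by (simp add: c1_def centre_Cm1_neg)
  have c1sq: "c1\<^sup>2 = l / n + 1 / (4 * p\<^sup>2 * q\<^sup>2 * n)"
    using n p q nu by (simp add: c1_def centre_Cm1_sq)
  then have c1gt: "c1\<^sup>2 > l / n" using p q n by simp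
  define B where "B = \<lceil>l\<^sup>2 * p\<^sup>2 * q\<^sup>2\<rceil>"
  define M where "M = l\<^sup>2 + 4 * n * l * B"
  have "walls_between n l p q \<subseteq> (\<lambda>(d, e). pencil_locus n l d e) ` ({- B..B} \<times> {- M..M})"
  proof
    fix W assume W: "W \<in> walls_between n l p q"
    then have neg: "\<And>s t. (s, t) \<in> W \<Longrightarrow> s < 0" and sur: "surrounds W (wall_Cm1 n l p q)"
      and ne: "W \<noteq> {}" and "W \<in> wall_locus n (mukai_v l) ` wall_vectors n (mukai_v l)"
      by (auto simp: walls_between_def walls_def)
    then obtain r d a where w: "(r, d, a) \<in> wall_vectors n (mukai_v l)"
      and locus: "W = wall_locus n (mukai_v l) (r, d, a)" by auto
    define e where "e = a + r * l"
    note w' = w[unfolded wall_vectors_iff]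
    have We: "W = pencil_locus n l d e"
      using wall_locus_eq_pencil_locus[OF n l] w' by (simp add: locus e_def)
    have nz: "d \<noteq> 0 \<or> e \<noteq> 0" using w' by (simp add: e_def)
    have D: "e\<^sup>2 > 4 * n * l * d\<^sup>2" using pencil_locus_nonempty_iff[OF n l nz] ne We by simp
    have "d \<noteq> 0"
    proof
      assume "d = 0"
      then have "(0, 1) \<in> W" using We by (simp add: pencil_locus_def)
      then show False using neg by blast
    qed
    define h k where "h = n * d\<^sup>2 - r * a" and "k = l * r - a"
    have hk: "h \<ge> 0" "l - k + h \<ge> 0" "k - 2 * h > 0" using w' by (auto simp: h_def k_def)
    \<comment> \<open>\<open>\<langle>w, v - w\<rangle>\<^sup>2 - \<langle>w\<^sup>2\<rangle> \<langle>(v - w)\<^sup>2\<rangle>\<close>\<close>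
    have "e\<^sup>2 - 4 * n * l * d\<^sup>2 = (k - 2 * h)\<^sup>2 - 4 * h * (l - k + h)"
      by (simp add: e_def h_def k_def algebra_simps power2_eq_square)
    also have "\<dots> \<le> (k - 2 * h)\<^sup>2" using hk by simp
    also have "\<dots> \<le> l\<^sup>2" using hk by (intro power_mono) auto
    finally have bound: "e\<^sup>2 - 4 * n * l * d\<^sup>2 \<le> l\<^sup>2" .
    define c :: real where "c = of_int e / (2 * of_int d * of_int n)"
    have Wc: "W = pencil_circle (l / n) c"
      using We pencil_locus_eq_circle[OF n \<open>d \<noteq> 0\<close>] by (simp add: c_def)
    have e: "real_of_int e = 2 * of_int d * of_int n * c" using n \<open>d \<noteq> 0\<close> by (simp add: c_def)
    have cgt: "c\<^sup>2 > l / n" using centre_sq_gt[OF n \<open>d \<noteq> 0\<close> D] by (simp add: c_def)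
    have "c < c1" using sur surrounds_pencil_circle_iff[of "l / n" c c1] cgt c1gt c1 n l
      unfolding Wc wall_Cm1_eq_circle[OF n p q] c1_def[symmetric] by simp
    then have "c\<^sup>2 \<ge> c1\<^sup>2" using c1 by (simp add: abs_le_square_iff[symmetric])
    then have "4 * (d * real_of_int n)\<^sup>2 * c1\<^sup>2 \<le> 4 * (d * real_of_int n)\<^sup>2 * c\<^sup>2" by (intro mult_left_mono) auto
    also have "\<dots> = (real_of_int e)\<^sup>2" unfolding e by algebra
    also have "\<dots> \<le> l\<^sup>2 + 4 * n * l * (real_of_int d)\<^sup>2"
    proof -
      have "real_of_int (e\<^sup>2 - 4 * n * l * d\<^sup>2) \<le> real_of_int (l\<^sup>2)"
        using bound by (rule of_int_le_iff[THEN iffD2])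
      then show ?thesis by simp
    qed
    finally have "d\<^sup>2 * n \<le> l\<^sup>2 * p\<^sup>2 * q\<^sup>2"
      unfolding c1sq using n p q by (simp add: field_simps power2_eq_square)
    moreover have "real_of_int (d\<^sup>2) * 1 \<le> of_int (d\<^sup>2) * of_int n" using n' by (intro mult_left_mono) auto
    ultimately have "real_of_int (d\<^sup>2) \<le> l\<^sup>2 * p\<^sup>2 * q\<^sup>2" by simp
    then have dB: "d\<^sup>2 \<le> B" unfolding B_def by linarith
    moreover have "\<bar>d\<bar> \<le> d\<^sup>2" 
      using self_le_power[of "\<bar>d\<bar>" 2] \<open>d \<noteq> 0\<close> by simp
    ultimately have d: "d \<in> {- B..B}" by auto
    have "4 * n * l * d\<^sup>2 \<le> 4 * n * l * B" using n l dB by (intro mult_left_mono) auto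
    then have "e\<^sup>2 \<le> M" using bound unfolding M_def by linarith
    moreover have "\<bar>e\<bar> \<le> e\<^sup>2"
      using self_le_power[of "\<bar>e\<bar>" 2] by (cases "e = 0") auto
    ultimately have "e \<in> {- M..M}" by auto
    then show "W \<in> (\<lambda>(d, e). pencil_locus n l d e) ` ({- B..B} \<times> {- M..M})" using d We by auto
  qed
  then show ?thesis by (rule finite_subset) auto
qed

lemma sends_wall_norm_unit:
  assumes n: "n > 0" and l: "l > 0" and nu: "norm_unit n l x y"
    and W: "W = wall_locus n (mukai_v l) (r, d, a)" "W \<noteq> {}"
    and w: "(r, d, a) \<in> wall_vectors n (mukai_v l)"
  obtains d' e' :: int where
    "d' * sqrt n = of_int (a + r * l) * (x * y) + d * sqrt n * (y\<^sup>2 + l * x\<^sup>2)"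
    "e' = of_int (a + r * l) * (y\<^sup>2 + l * x\<^sup>2) + 4 * of_int l * (x * y) * (d * sqrt n)"
    "e'\<^sup>2 > 4 * n * l * d'\<^sup>2"
    "pencil_locus n l d' e' \<in> walls n (mukai_v l)"
    "sends_wall n (mukai_v l) (mat2 y (l * x) x y) W (pencil_locus n l d' e')"
proof -
  define N where "N = sqrt n"
  have N: "N * N = n" "N > 0" using n by (auto simp: N_def)
  have sq: "(y\<^sup>2 - l * x\<^sup>2)\<^sup>2 = 1" using norm_unit_norm[OF nu] by auto
  note act = mukai_act_norm_unit[OF n nu, folded N_def]
  have image: "\<exists>d' e'. d' * N = of_int (a + r * l) * (x * y) + d * N * (y\<^sup>2 + l * x\<^sup>2) \<and>
    e' = of_int (a + r * l) * (y\<^sup>2 + l * x\<^sup>2) + 4 * of_int l * (x * y) * (d * N) \<and>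
    e'\<^sup>2 > 4 * n * l * d'\<^sup>2 \<and>
    wall_locus n (mukai_v l) (mukai_act n (r, d, a) (mat2 y (l * x) x y)) = pencil_locus n l d' e' \<and>
    pencil_locus n l d' e' \<in> walls n (mukai_v l)"
    if w: "(r, d, a) \<in> wall_vectors n (mukai_v l)" "wall_locus n (mukai_v l) (r, d, a) \<noteq> {}"
    for r d a :: int
  proof -
    obtain r' d' a' where g: "mukai_act n (r, d, a) (mat2 y (l * x) x y) = (r', d', a')"
      and d': "d' * N = of_int (a + r * l) * (x * y) + d * N * (y\<^sup>2 + l * x\<^sup>2)"
      and e': "of_int (a' + r' * l) = of_int (a + r * l) * (y\<^sup>2 + l * x\<^sup>2) + 4 * of_int l * (x * y) * (d * N)"
      and h: "n * d'\<^sup>2 - r' * a' = n * d\<^sup>2 - r * a"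
      and k: "l * r' - a' = l * r - a \<or> l * r' - a' = - (l * r - a)" by (rule act)
    note w' = w(1)[unfolded wall_vectors_iff]
    have D: "(a + r * l)\<^sup>2 > 4 * n * l * d\<^sup>2"
      using pencil_locus_nonempty_iff[OF n l, of d "a + r * l"] w
        wall_locus_eq_pencil_locus[OF n l, of d a r] w' by simp
    have "(a + r * l)\<^sup>2 - 4 * n * l * d\<^sup>2 = (l * r - a)\<^sup>2 - 4 * l * (n * d\<^sup>2 - r * a)"
      by (simp add: algebra_simps power2_eq_square)
    also have "\<dots> = (l * r' - a')\<^sup>2 - 4 * l * (n * d'\<^sup>2 - r' * a')"
      using k unfolding h by (elim disjE) (simp_all only: power2_minus)
    also have "\<dots> = (a' + r' * l)\<^sup>2 - 4 * n * l * d'\<^sup>2"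
      by (simp add: algebra_simps power2_eq_square)
    finally have D': "(a' + r' * l)\<^sup>2 > 4 * n * l * d'\<^sup>2" using D by linarith
    then have nz': "d' \<noteq> 0 \<or> a' + r' * l \<noteq> 0" by fastforce
    have loc: "wall_locus n (mukai_v l) (r', d', a') = pencil_locus n l d' (a' + r' * l)"
      using wall_locus_eq_pencil_locus[OF n l nz'] w' h by simp
    have ne: "pencil_locus n l d' (a' + r' * l) \<noteq> {}"
      using pencil_locus_nonempty_iff[OF n l nz'] D' by simp
    \<comment> \<open>If \<open>v \<cdot> g = - v\<close>, then \<open>- w \<cdot> g\<close> is the wall vector defining the image.\<close>
    have "\<exists>u \<in> wall_vectors n (mukai_v l). wall_locus n (mukai_v l) u = pencil_locus n l d' (a' + r' * l)"
    proof (cases "l * r' - a' = l * r - a")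
      case True
      then have "(r', d', a') \<in> wall_vectors n (mukai_v l)"
        using w' h nz' unfolding wall_vectors_iff by simp
      then show ?thesis using loc by blast
    next
      case False
      then have k': "l * (- r') - (- a') = l * r - a" using k by simp
      have nz'': "- d' \<noteq> 0 \<or> - a' + - r' * l \<noteq> 0" using nz' by auto
      have h': "n * (- d')\<^sup>2 - (- r') * (- a') = n * d\<^sup>2 - r * a" using h by simp
      have "(- r', - d', - a') \<in> wall_vectors n (mukai_v l)"
        using w' unfolding wall_vectors_iff k' h' using nz'' by simp
      moreover have "wall_locus n (mukai_v l) (- r', - d', - a') = pencil_locus n l (- d') (- a' + - r' * l)"
        using wall_locus_eq_pencil_locus[OF n l nz''] w' h' by simp
      moreover have "pencil_locus n l (- d') (- a' + - r' * l) = pencil_locus n l d' (a' + r' * l)"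
        using nz' nz'' by (intro pencil_locus_cong) (auto simp: algebra_simps)
      ultimately show ?thesis by auto
    qed
    then have "pencil_locus n l d' (a' + r' * l) \<in> walls n (mukai_v l)"
      using ne by (auto simp: walls_def)
    then show ?thesis using d' e' D' loc unfolding g
      by (intro exI[of _ d'] exI[of _ "a' + r' * l"] conjI) assumption+
  qed
  obtain d' e' where d': "d' * N = of_int (a + r * l) * (x * y) + d * N * (y\<^sup>2 + l * x\<^sup>2)"
    and e': "e' = of_int (a + r * l) * (y\<^sup>2 + l * x\<^sup>2) + 4 * of_int l * (x * y) * (d * N)"
    and D': "e'\<^sup>2 > 4 * n * l * d'\<^sup>2" and wall: "pencil_locus n l d' e' \<in> walls n (mukai_v l)"
    using image[OF w W(2)[unfolded W(1)]] by blast
  have "wall_locus n (mukai_v l) (mukai_act n u (mat2 y (l * x) x y)) = pencil_locus n l d' e'"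
    if u: "u \<in> wall_vectors n (mukai_v l)" "wall_locus n (mukai_v l) u = W" for u
  proof -
    obtain r2 d2 a2 where ueq: "u = (r2, d2, a2)" by (metis surj_pair)
    obtain d'' e'' where d'': "d'' * N = of_int (a2 + r2 * l) * (x * y) + d2 * N * (y\<^sup>2 + l * x\<^sup>2)"
      and e'': "e'' = of_int (a2 + r2 * l) * (y\<^sup>2 + l * x\<^sup>2) + 4 * of_int l * (x * y) * (d2 * N)"
      and D'': "e''\<^sup>2 > 4 * n * l * d''\<^sup>2"
      and loc: "wall_locus n (mukai_v l) (mukai_act n u (mat2 y (l * x) x y)) = pencil_locus n l d'' e''"
      using image[OF u(1)[unfolded ueq] W(2)[folded u(2), unfolded ueq]] unfolding ueq by blast
    have "pencil_locus n l d (a + r * l) = W"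
      using w W wall_locus_eq_pencil_locus[OF n l] unfolding wall_vectors_iff by simp
    moreover have "pencil_locus n l d2 (a2 + r2 * l) = W"
      using u wall_locus_eq_pencil_locus[OF n l] unfolding ueq wall_vectors_iff by simp
    ultimately have "d * (a2 + r2 * l) = d2 * (a + r * l)"
      using pencil_locus_determines_ratio[OF n l] W by metis
    then have ratio: "real_of_int d * of_int (a2 + r2 * l) = of_int d2 * of_int (a + r * l)"
      by (metis of_int_mult)
    have "(d'' * N) * e' = (d' * N) * e''"
      unfolding d' d'' e' e'' using ratio by algebra
    then have "real_of_int (d'' * e') = of_int (d' * e'')" using N by simp
    then have "d'' * e' = d' * e''" unfolding of_int_eq_iff .
    moreover have "d'' \<noteq> 0 \<or> e'' \<noteq> 0" "d' \<noteq> 0 \<or> e' \<noteq> 0" using D' D'' by fastforce+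
    ultimately show ?thesis unfolding loc by (intro pencil_locus_cong) auto
  qed
  moreover have "W \<in> walls n (mukai_v l)" using W w by (auto simp: walls_def)
  ultimately have "sends_wall n (mukai_v l) (mat2 y (l * x) x y) W (pencil_locus n l d' e')"
    unfolding sends_wall_def by blast
  then show ?thesis using that d' e' D' wall unfolding N_def by blast
qed

text \<open>With \<open>u = e/D\<close>, \<open>P = p q\<close> and \<open>T = q\<^sup>2 + l p\<^sup>2\<close>, the slope of \<open>C\<^sub>-\<^sub>1\<close> is \<open>- T/P\<close>.\<close>

lemma ratio_lt_of_multiplier:
  fixes b u P T :: real
  assumes "b > 0" "P > 0" "T > b * P" "u\<^sup>2 > b\<^sup>2"
    and "(u + b) / (u - b) \<le> 1" "(u + b) / (u - b) > (T - b * P) / (T + b * P)"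
  shows "u < - T / P"
proof -
  have "u < b"
  proof (rule ccontr)
    assume "\<not> u < b"
    then have "u - b > 0" using assms(4) by (cases "u = b") auto
    then show False using assms(1,5) by (simp add: divide_le_eq)
  qed
  have "T + b * P > 0" using assms by (smt (verit) mult_pos_pos)
  have "(T - b * P) * (u - b) > (u + b) * (T + b * P)"
    using assms(6) \<open>u < b\<close> \<open>T + b * P > 0\<close> by (simp add: field_simps)
  then have "2 * b * (T + P * u) < 0" by (simp add: algebra_simps)
  then have "T + P * u < 0" using assms(1) by (simp add: mult_less_0_iff)
  then show ?thesis using assms(2) by (simp add: field_simps)
qed

lemma exists_powi_in_fundamental_interval:
  fixes \<mu> \<eta> :: real
  assumes "\<mu> > 0" "\<eta> > 1"
  shows "\<exists>k. \<mu> * \<eta> powi k \<le> 1 \<and> \<mu> * \<eta> powi k > inverse \<eta>"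
proof -
  define j where "j = \<lceil>log \<eta> \<mu>\<rceil>"
  have \<mu>: "\<mu> = \<eta> powr (log \<eta> \<mu>)" using assms by simp
  have pw: "\<eta> powi k = \<eta> powr k" for k using assms by (simp add: powr_real_of_int')
  have "\<mu> * \<eta> powi (- j) = \<eta> powr (log \<eta> \<mu> - j)"
    unfolding pw by (subst \<mu>) (simp flip: powr_add del: powr_log_cancel)
  moreover have "\<eta> powr (log \<eta> \<mu> - j) \<le> \<eta> powr 0"
    using assms by (intro powr_mono) (auto simp: j_def)
  moreover have "\<eta> powr (log \<eta> \<mu> - j) > \<eta> powr (- 1)"
    using assms by (intro powr_less_mono) (auto simp: j_def, linarith)
  ultimately show ?thesis using assms
    by (intro exI[of _ "- j"]) (simp add: powr_minus)
qed

theorem proposition6p17: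
  fixes n l :: int and p q :: real
  assumes "n > 0"
    and "l > 1"
    and "sqrt (of_int (l * n)) \<notin> \<int>"
    and "p > 0" and "q > 0"
    and "generates_S_mod_pm1 n l (mat2 q (of_int l * p) p q)"
  shows "finite (walls_between n l p q) \<and>
    (\<forall>W \<in> walls n (mukai_v l). \<exists>g \<in> G_group n l. \<exists>W'.
        sends_wall n (mukai_v l) g W W' \<and> W' \<in> walls n (mukai_v l) \<and>
        (W' \<in> walls_between n l p q \<or> W' = wall_C0 \<or> W' = wall_Cm1 n l p q))"
proof (intro conjI ballI)
  have n: "n > 0" and l: "l > 0" and p: "p > 0" and q: "q > 0" using assms by auto
  have nu: "norm_unit n l p q"
    using assms(6) by (simp add: generates_S_mod_pm1_def mat2_mem_S_group_iff)
  show "finite (walls_between n l p q)" by (rule finite_walls_between[OF n l p q nu])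
  fix W assume "W \<in> walls n (mukai_v l)"
  then obtain r d a where w: "(r, d, a) \<in> wall_vectors n (mukai_v l)"
    and W: "W = wall_locus n (mukai_v l) (r, d, a)" "W \<noteq> {}"
    by (auto simp: walls_def)
  define N L b where "N = sqrt n" and "L = sqrt l" and "b = 2 * L"
  have N: "N > 0" "N\<^sup>2 = n" and L: "L > 0" "L\<^sup>2 = l" using n l by (auto simp: N_def L_def)
  have b: "b > 0" "b\<^sup>2 = 4 * l" using L by (auto simp: b_def power_mult_distrib)
  define e D where "e = a + r * l" and "D = d * N"
  define \<epsilon> where "\<epsilon> = q + L * p"
  have Lp: "L * p > 0" using L p by simp
  have conj: "((q + L * p) * (q - L * p))\<^sup>2 = 1"
  proof -
    have "(q + L * p) * (q - L * p) = q\<^sup>2 - L\<^sup>2 * p\<^sup>2" by algebra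
    then show ?thesis using norm_unit_norm[OF nu] unfolding L(2) by auto
  qed
  have \<epsilon>: "\<epsilon> > 1"
  proof (rule ccontr)
    assume "\<not> \<epsilon> > 1"
    moreover have "\<bar>q - L * p\<bar> < \<epsilon>" using Lp q by (auto simp: \<epsilon>_def abs_if)
    moreover have "\<epsilon> * \<bar>q - L * p\<bar> = 1"
    proof -
      have "\<epsilon> * \<bar>q - L * p\<bar> = \<bar>(q + L * p) * (q - L * p)\<bar>"
        using Lp q by (simp add: \<epsilon>_def abs_mult)
      then show ?thesis using conj by (simp add: abs_square_eq_1)
    qed
    ultimately show False
      using Lp q mult_strict_mono'[of "\<bar>q - L * p\<bar>" 1 \<epsilon> \<epsilon>] by (smt (verit) mult_le_one mult_left_le_one_le abs_ge_zero)
  qed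
  have D2: "(real_of_int e)\<^sup>2 > b\<^sup>2 * D\<^sup>2"
  proof -
    have "e\<^sup>2 > 4 * n * l * d\<^sup>2"
      using w W wall_locus_eq_pencil_locus[OF n l, of d a r] pencil_locus_nonempty_iff[OF n l, of d e]
      unfolding wall_vectors_iff e_def by simp
    then have "real_of_int (e\<^sup>2) > real_of_int (4 * n * l * d\<^sup>2)" by linarith
    then show ?thesis by (simp add: b D_def power_mult_distrib N algebra_simps)
  qed
  define \<mu> where "\<mu> = (e + b * D) / (e - b * D)"
  have "(e + b * D) * (e - b * D) > 0" using D2 by (simp add: algebra_simps power2_eq_square)
  then have \<mu>: "\<mu> > 0" and ne: "e - b * D \<noteq> 0"
    by (auto simp: \<mu>_def zero_less_mult_iff zero_less_divide_iff)
  have "\<epsilon> ^ 4 > 1" using \<epsilon> by simp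
  then obtain k where k: "\<mu> * (\<epsilon> ^ 4) powi k \<le> 1" "\<mu> * (\<epsilon> ^ 4) powi k > inverse (\<epsilon> ^ 4)"
    using exists_powi_in_fundamental_interval[OF \<mu>] by blast
  obtain x y where xy: "norm_unit n l x y" and "(y + L * x)\<^sup>2 = (\<epsilon>\<^sup>2) powi k"
    using norm_unit_powi[OF nu l, of k] unfolding L_def \<epsilon>_def by blast
  then have "((y + L * x)\<^sup>2)\<^sup>2 = ((\<epsilon>\<^sup>2)\<^sup>2) powi k"
    by (simp add: power_int_mult_distrib power2_eq_square)
  then have yk: "(y + L * x) ^ 4 = (\<epsilon> ^ 4) powi k" by simp
  obtain d' e' :: int where d': "d' * N = of_int e * (x * y) + D * (y\<^sup>2 + l * x\<^sup>2)"
    and e': "e' = of_int e * (y\<^sup>2 + l * x\<^sup>2) + 4 * of_int l * (x * y) * D"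
    and D': "e'\<^sup>2 > 4 * n * l * d'\<^sup>2"
    and wall: "pencil_locus n l d' e' \<in> walls n (mukai_v l)"
    and sends: "sends_wall n (mukai_v l) (mat2 y (l * x) x y) W (pencil_locus n l d' e')"
    by (rule sends_wall_norm_unit[OF n l xy W w, folded e_def N_def, folded D_def])
  have g: "mat2 y (l * x) x y \<in> G_group n l" by (rule norm_unit_mat2_mem_G_group[OF xy])
  have plus: "e' + b * (d' * N) = (e + b * D) * (y + L * x)\<^sup>2"
    and minus: "e' - b * (d' * N) = (e - b * D) * (y - L * x)\<^sup>2"
    unfolding d' e' b_def L(2)[symmetric] by algebra+
  have xy1: "(y - L * x)\<^sup>2 * (y + L * x)\<^sup>2 = 1"
  proof -
    have "(y - L * x)\<^sup>2 * (y + L * x)\<^sup>2 = (y\<^sup>2 - L\<^sup>2 * x\<^sup>2)\<^sup>2" by algebra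
    then show ?thesis using norm_unit_norm[OF xy] unfolding L(2) by auto
  qed
  have \<mu>': "(e' + b * (d' * N)) / (e' - b * (d' * N)) = \<mu> * (\<epsilon> ^ 4) powi k"
  proof -
    have "(y + L * x)\<^sup>2 / (y - L * x)\<^sup>2 = (y + L * x) ^ 4"
      using xy1 by (auto simp: divide_eq_eq) algebra
    then show ?thesis unfolding plus minus yk[symmetric] \<mu>_def
      by (metis times_divide_times_eq)
  qed
  have "pencil_locus n l d' e' \<in> walls_between n l p q \<or> pencil_locus n l d' e' = wall_C0"
  proof (cases "d' = 0")
    case True
    then have "e' \<noteq> 0" using D' by auto
    then show ?thesis using True pencil_locus_zero[OF n l] by simp
  next
    case False
    define c c1 :: real where "c = of_int e' / (2 * of_int d' * of_int n)" and "c1 = centre_Cm1 n l p q"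
    define u where "u = e' / (d' * N)"
    have u: "real_of_int e' = u * (d' * N)" using False N by (simp add: u_def)
    have Tm: "q\<^sup>2 + l * p\<^sup>2 - b * (p * q) = (q - L * p)\<^sup>2"
      and Tp: "q\<^sup>2 + l * p\<^sup>2 + b * (p * q) = \<epsilon>\<^sup>2"
      unfolding b_def L(2)[symmetric] \<epsilon>_def by algebra+
    have "q - L * p \<noteq> 0" using conj by auto
    then have T: "q\<^sup>2 + l * p\<^sup>2 > b * (p * q)" using Tm by (smt (verit) zero_less_power2)
    have "real_of_int (e'\<^sup>2) > real_of_int (4 * n * l * d'\<^sup>2)" using D' by linarith
    then have "(real_of_int e')\<^sup>2 > b\<^sup>2 * (d' * N)\<^sup>2"
      by (simp add: b power_mult_distrib N algebra_simps)
    then have ub: "u\<^sup>2 > b\<^sup>2" using False N(1) unfolding u by (simp add: power_mult_distrib)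
    have "(e' + b * (d' * N)) / (e' - b * (d' * N)) = (u + b) / (u - b)"
      unfolding u distrib_right[symmetric] left_diff_distrib[symmetric] using False N by simp
    note mult = this[unfolded \<mu>']
    have "(q - L * p)\<^sup>2 / \<epsilon>\<^sup>2 = inverse (\<epsilon> ^ 4)"
    proof -
      have "(q - L * p)\<^sup>2 * \<epsilon>\<^sup>2 = 1" using conj unfolding \<epsilon>_def by algebra
      then have "(q - L * p)\<^sup>2 * \<epsilon> ^ 4 = \<epsilon>\<^sup>2" by algebra
      then show ?thesis using \<epsilon> by (simp add: field_simps)
    qed
    then have "u < - (q\<^sup>2 + l * p\<^sup>2) / (p * q)"
      using ratio_lt_of_multiplier[OF b(1) _ T ub] k p q unfolding mult Tm Tp by simp
    then have "u / (2 * N) < - (q\<^sup>2 + l * p\<^sup>2) / (p * q) / (2 * N)"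
      using N by (intro divide_strict_right_mono) auto
    moreover have "c = u / (2 * N)" using N(1) by (simp add: c_def u_def flip: N(2)) (simp add: field_simps power2_eq_square)
    moreover have "c1 = - (q\<^sup>2 + l * p\<^sup>2) / (p * q) / (2 * N)"
      unfolding c1_def centre_Cm1_def N_def[symmetric] minus_divide_left divide_divide_eq_left
      by (simp only: mult_ac)
    ultimately have cc: "c < c1" by simp
    have c1: "c1 < 0" using n l p q by (simp add: c1_def centre_Cm1_neg)
    have k0: "real_of_int l / n > 0" using n l by simp
    have cm: "wall_Cm1 n l p q = pencil_circle (l / n) c1"
      using wall_Cm1_eq_circle[OF n p q] by (simp add: c1_def N_def)
    have loc: "pencil_locus n l d' e' = pencil_circle (l / n) c"
      using pencil_locus_eq_circle[OF n False] by (simp add: c_def)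
    have "l / n < c1\<^sup>2" using n p q by (simp add: c1_def centre_Cm1_sq[OF n p q nu])
    moreover have "l / n < c\<^sup>2" using centre_sq_gt[OF n False D'] by (simp add: c_def)
    ultimately have "surrounds (pencil_locus n l d' e') (wall_Cm1 n l p q)"
      unfolding loc cm using surrounds_pencil_circle_iff k0 c1 cc by blast
    moreover have "s < 0" if "(s, t) \<in> pencil_locus n l d' e'" for s t
    proof -
      have "2 * c * s = s\<^sup>2 + t\<^sup>2 + l / n" using that unfolding loc by (simp add: pencil_circle_def)
      also have "\<dots> > 0" using k0 by (smt (verit) zero_le_power2)
      finally show ?thesis using cc c1 by (simp add: zero_less_mult_iff)
    qed
    ultimately show ?thesis using wall by (auto simp: walls_between_def)
  qed
  then show "\<exists>g \<in> G_group n l. \<exists>W'. sends_wall n (mukai_v l) g W W' \<and> W' \<in> walls n (mukai_v l) \<and>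
        (W' \<in> walls_between n l p q \<or> W' = wall_C0 \<or> W' = wall_Cm1 n l p q)"
    using g sends wall by blast
qed

end
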